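(* Let $n\ge m\ge 3$ be integers. Then the total graph $T(S_n\square S_m)$ of the Cartesian product of the star graphs $S_n$ and $S_m$ satisfies $$\varphi(T(S_n\square S_m))=\begin{cases}2m+n+1, & \text{if } n>2(m-1),\\ 2n+3, & \text{if } n\le 2(m-1).\end{cases}$$
   Context: All graphs are finite, simple, undirected and connected. The star graph $S_n$ has $n+1$ vertices: a central vertex adjacent to each of $n$ other vertices, and no two of these $n$ vertices are adjacent (so $S_n=K_{1,n}$). The Cartesian product $G\square H$ has vertex set $V(G)\times V(H)$, with $(u,v)$ and $(u',v')$ adjacent if and only if either $v=v'$ and $u\sim u'$ in $G$, or $u=u'$ and $v\sim v'$ in $H$. The total graph $T(G)$ has vertex set $V(G)\cup E(G)$, with two distinct elements adjacent if and only if they are two adjacent vertices of $G$, or a vertex of $G$ and an edge of $G$ incident to it, or two edges of $G$ sharing an endpoint. In a proper coloring of $G$ with $k$ colors, a vertex of color $i$ is a $b$-vertex if for each color $j\ne i$ it is adjacent to at least one vertex of color $j$; a proper coloring is a $b$-coloring if every one of its colors $i\in\{1,\dots,k\}$ has at least one $b$-vertex of color $i$. The $b$-chromatic number $\varphi(G)$ is the largest integer $k$ such that $G$ has a $b$-coloring with $k$ colors. *)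

theory Defs
  imports Main
begin

(* A graph is a pair (vertices, edges), each edge being the two-element set of its ends. *)
type_synonym 'a graph = "'a set \<times> 'a set set"

abbreviation verts :: "'a graph \<Rightarrow> 'a set" where
  "verts G \<equiv> fst G"

abbreviation edges :: "'a graph \<Rightarrow> 'a set set" where
  "edges G \<equiv> snd G"

definition simple_graph :: "'a graph \<Rightarrow> bool" where
  "simple_graph G \<longleftrightarrow> finite (verts G) \<and> (\<forall>e\<in>edges G. e \<subseteq> verts G \<and> card e = 2)"

definition adj :: "'a graph \<Rightarrow> 'a \<Rightarrow> 'a \<Rightarrow> bool" where
  "adj G u v \<longleftrightarrow> {u, v} \<in> edges G"

(* The centre is 0, the leaves are 1, ..., n. *)
definition star_graph :: "nat \<Rightarrow> nat graph" where
  "star_graph n = ({0..n}, {{0, i} | i. i \<in> {1..n}})"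

definition cart_prod :: "'a graph \<Rightarrow> 'b graph \<Rightarrow> ('a \<times> 'b) graph" where
  "cart_prod G H =
    (verts G \<times> verts H,
     {{(u, v), (u', v')} | u v u' v'.
        (u, v) \<in> verts G \<times> verts H \<and> (u', v') \<in> verts G \<times> verts H \<and>
        (v = v' \<and> adj G u u' \<or> u = u' \<and> adj H v v')})"

(* Inl marks the vertices of G and Inr its edges. *)
fun total_adj :: "'a graph \<Rightarrow> 'a + 'a set \<Rightarrow> 'a + 'a set \<Rightarrow> bool" where
  "total_adj G (Inl u) (Inl v) \<longleftrightarrow> adj G u v"
| "total_adj G (Inl u) (Inr e) \<longleftrightarrow> u \<in> e"
| "total_adj G (Inr e) (Inl u) \<longleftrightarrow> u \<in> e"
| "total_adj G (Inr e) (Inr f) \<longleftrightarrow> e \<inter> f \<noteq> {}"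

definition total_graph :: "'a graph \<Rightarrow> ('a + 'a set) graph" where
  "total_graph G =
    (verts G <+> edges G,
     {{x, y} | x y. x \<in> verts G <+> edges G \<and> y \<in> verts G <+> edges G \<and>
                    x \<noteq> y \<and> total_adj G x y})"

definition proper_coloring :: "'a graph \<Rightarrow> nat \<Rightarrow> ('a \<Rightarrow> nat) \<Rightarrow> bool" where
  "proper_coloring G k c \<longleftrightarrow>
    (\<forall>v\<in>verts G. c v \<in> {1..k}) \<and>
    (\<forall>u\<in>verts G. \<forall>v\<in>verts G. adj G u v \<longrightarrow> c u \<noteq> c v)"

definition b_vertex :: "'a graph \<Rightarrow> nat \<Rightarrow> ('a \<Rightarrow> nat) \<Rightarrow> 'a \<Rightarrow> bool" where
  "b_vertex G k c v \<longleftrightarrow>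
    v \<in> verts G \<and> (\<forall>j\<in>{1..k}. j \<noteq> c v \<longrightarrow> (\<exists>w\<in>verts G. adj G v w \<and> c w = j))"

definition b_coloring :: "'a graph \<Rightarrow> nat \<Rightarrow> ('a \<Rightarrow> nat) \<Rightarrow> bool" where
  "b_coloring G k c \<longleftrightarrow>
    proper_coloring G k c \<and> (\<forall>i\<in>{1..k}. \<exists>v. b_vertex G k c v \<and> c v = i)"

definition b_chromatic_number :: "'a graph \<Rightarrow> nat" where
  "b_chromatic_number G = Max {k. \<exists>c. b_coloring G k c}"

lemma simple_graph_star_graph: "simple_graph (star_graph n)"
  by (auto simp: simple_graph_def star_graph_def)

lemma simple_graph_cart_prod:
  assumes "simple_graph G" "simple_graph H"
  shows "simple_graph (cart_prod G H)"
proof -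
  have "u \<noteq> u'" if "adj G u u'" for u u'
    using assms(1) that by (force simp: simple_graph_def adj_def)
  moreover have "v \<noteq> v'" if "adj H v v'" for v v'
    using assms(2) that by (force simp: simple_graph_def adj_def)
  ultimately show ?thesis
    using assms by (auto simp: simple_graph_def cart_prod_def)
qed

lemma simple_graph_total_graph:
  assumes "simple_graph G"
  shows "simple_graph (total_graph G)"
proof -
  have "finite (edges G)"
    by (rule finite_subset[of _ "Pow (verts G)"]) (use assms in \<open>auto simp: simple_graph_def\<close>)
  then have "finite (verts (total_graph G))"
    using assms by (simp add: simple_graph_def total_graph_def)
  moreover have "e \<subseteq> verts (total_graph G) \<and> card e = 2" if e: "e \<in> edges (total_graph G)" for e
  proof -
    obtain x y where "e = {x, y}" "x \<in> verts G <+> edges G" "y \<in> verts G <+> edges G" "x \<noteq> y"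
      using e unfolding total_graph_def snd_conv by blast
    then show ?thesis by (simp add: total_graph_def)
  qed
  ultimately show ?thesis by (simp add: simple_graph_def)
qed

(* The maximum is taken over a finite set: all k colors of a b-coloring occur on vertices. *)
lemma b_coloring_le_card:
  assumes "simple_graph G" "b_coloring G k c"
  shows "k \<le> card (verts G)"
proof -
  have "{1..k} \<subseteq> c ` verts G"
    using assms(2) by (fastforce simp: b_coloring_def b_vertex_def)
  then have "card {1..k} \<le> card (verts G)"
    using assms(1) by (intro surj_card_le) (auto simp: simple_graph_def)
  then show ?thesis by simp
qed

end

(* Upper bound: a b-coloring with k colors needs k vertices of degree at least k - 1, and in the
   total graph only (0,0), the edges at (0,0) and the vertices (0,j) have large degree, the latter
   having degree at most 2n + 2.

   Lower bound: (0,0) and the edges at it form a clique of 1 + n + m vertices, which all become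
   b-vertices of distinct colors.  In addition t of the vertices (0,j) receive private colors and
   become b-vertices.  For j <= t the edges (0,j)-(i,j) and the vertices (i,j) must together show
   to (0,j) all colors it misses, t - 1 of the former being reserved for the private colors.  This
   can be done with cyclic shifts as soon as t <= m and t + m <= n + 2; the largest such t
   is m if n > 2(m - 1) and n + 2 - m otherwise, giving both cases of the formula. *)

theory Submission imports Defs begin

section \<open>Neighbourhoods and the degree bound for b-colorings\<close>

definition nbrs :: "'a graph \<Rightarrow> 'a \<Rightarrow> 'a set" where
  "nbrs G v = {w \<in> verts G. adj G v w}"

lemma adj_commute: "adj G u v \<longleftrightarrow> adj G v u"
  by (simp add: adj_def insert_commute)

lemma simple_graph_adjD:
  assumes "simple_graph G" "adj G u v"
  shows "u \<in> verts G" "v \<in> verts G" "u \<noteq> v"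
  using assms by (force simp: simple_graph_def adj_def)+

lemma simple_graph_edgeE:
  assumes "simple_graph G" "e \<in> edges G"
  obtains u v where "e = {u, v}" "adj G u v"
proof -
  have "card e = 2" using assms by (auto simp: simple_graph_def)
  then obtain u v where "e = {u, v}" by (auto simp: card_2_iff)
  then show ?thesis using that assms(2) by (simp add: adj_def)
qed

lemma finite_nbrs: "simple_graph G \<Longrightarrow> finite (nbrs G v)"
  by (simp add: nbrs_def simple_graph_def)

text \<open>A b-vertex sees the \<open>k - 1\<close> colors other than its own, so its degree is at
  least \<open>k - 1\<close>. The b-vertices of different colors are different, which gives
  \<open>k\<close> such vertices.\<close>

lemma b_coloring_le_card_degree:
  assumes G: "simple_graph G" and c: "b_coloring G k c"
  shows "k \<le> card {v \<in> verts G. k \<le> card (nbrs G v) + 1}"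
proof -
  have "{1..k} \<subseteq> c ` {v \<in> verts G. k \<le> card (nbrs G v) + 1}"
  proof
    fix i assume i: "i \<in> {1..k}"
    then obtain v where v: "b_vertex G k c v" "c v = i"
      using c unfolding b_coloring_def by blast
    have "{1..k} - {i} \<subseteq> c ` nbrs G v"
      using v by (fastforce simp: b_vertex_def nbrs_def)
    then have "card ({1..k} - {i}) \<le> card (nbrs G v)"
      by (rule surj_card_le[OF finite_nbrs[OF G]])
    then have "k \<le> card (nbrs G v) + 1" using i by simp
    then show "i \<in> c ` {v \<in> verts G. k \<le> card (nbrs G v) + 1}"
      using v by (auto simp: b_vertex_def)
  qed
  then have "card {1..k} \<le> card {v \<in> verts G. k \<le> card (nbrs G v) + 1}"
    using G by (intro surj_card_le) (auto simp: simple_graph_def)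
  then show ?thesis by simp
qed

text \<open>The bound on all \<open>l\<close> also makes the set of attainable numbers finite, which
  is what gives \<open>Max\<close> its meaning.\<close>

lemma b_chromatic_number_eqI:
  assumes "simple_graph G" "b_coloring G k c" "\<And>l d. b_coloring G l d \<Longrightarrow> l \<le> k"
  shows "b_chromatic_number G = k"
proof -
  have "finite {k. \<exists>c. b_coloring G k c}"
    using assms(3) by (auto simp: finite_nat_set_iff_bounded_le)
  then show ?thesis
    unfolding b_chromatic_number_def using assms(2,3) by (intro Max_eqI) auto
qed

section \<open>Adjacency and degrees in total graphs\<close>

lemma total_adj_commute: "total_adj G x y \<longleftrightarrow> total_adj G y x"
  by (cases x; cases y) (auto simp: adj_commute)

lemma verts_total_graph: "verts (total_graph G) = verts G <+> edges G"
  by (simp add: total_graph_def)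

lemma adj_total_graph:
  "adj (total_graph G) x y \<longleftrightarrow>
    x \<in> verts G <+> edges G \<and> y \<in> verts G <+> edges G \<and> x \<noteq> y \<and> total_adj G x y"
  by (auto simp: adj_def total_graph_def doubleton_eq_iff total_adj_commute)

text \<open>Each neighbour \<open>u\<close> of \<open>v\<close> accounts for two neighbours in the
  total graph: \<open>u\<close> itself and the edge \<open>{v, u}\<close>.\<close>

lemma card_nbrs_total_graph_Inl:
  assumes G: "simple_graph G"
  shows "card (nbrs (total_graph G) (Inl v)) \<le> 2 * card (nbrs G v)"
proof -
  let ?A = "nbrs G v"
  have "nbrs (total_graph G) (Inl v) \<subseteq> Inl ` ?A \<union> (\<lambda>u. Inr {v, u}) ` ?A"
  proof
    fix x assume "x \<in> nbrs (total_graph G) (Inl v)"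
    then have x: "x \<in> verts G <+> edges G" "total_adj G (Inl v) x"
      by (auto simp: nbrs_def adj_total_graph)
    show "x \<in> Inl ` ?A \<union> (\<lambda>u. Inr {v, u}) ` ?A"
    proof (cases x)
      case (Inl u)
      then show ?thesis using x by (auto simp: nbrs_def)
    next
      case (Inr e)
      then have e: "e \<in> edges G" "v \<in> e" using x by auto
      then obtain a b where ab: "e = {a, b}" "adj G a b"
        using simple_graph_edgeE[OF G] by blast
      then have "\<exists>u. e = {v, u} \<and> adj G v u"
        using e(2) adj_commute by (metis insert_commute insert_iff singletonD)
      then show ?thesis
        using Inr simple_graph_adjD[OF G] by (auto simp: nbrs_def)
    qed
  qed
  then have "card (nbrs (total_graph G) (Inl v)) \<le> card (Inl ` ?A \<union> (\<lambda>u. Inr {v, u}) ` ?A)"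
    by (intro card_mono) (auto simp: finite_nbrs[OF G])
  also have "\<dots> \<le> card (Inl ` ?A :: ('a + 'a set) set) +
      card ((\<lambda>u. Inr {v, u}) ` ?A :: ('a + 'a set) set)"
    by (rule card_Un_le)
  also have "\<dots> \<le> card ?A + card ?A"
    by (intro add_mono card_image_le finite_nbrs[OF G])
  finally show ?thesis by simp
qed

text \<open>An edge is adjacent to its two ends and to the other edges at either end. Leaving out
  the edge itself at both ends offsets the 2 coming from the ends.\<close>

lemma card_nbrs_total_graph_Inr:
  assumes G: "simple_graph G" and uv: "adj G u v"
  shows "card (nbrs (total_graph G) (Inr {u, v})) \<le> card (nbrs G u) + card (nbrs G v)"
proof -
  let ?A = "nbrs G u - {v}" and ?B = "nbrs G v - {u}"
  let ?S = "{Inl u, Inl v} \<union> ((\<lambda>w. Inr {u, w}) ` ?A \<union> (\<lambda>w. Inr {v, w}) ` ?B)"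
  have "nbrs (total_graph G) (Inr {u, v}) \<subseteq> ?S"
  proof
    fix x assume "x \<in> nbrs (total_graph G) (Inr {u, v})"
    then have x: "x \<in> verts G <+> edges G" "total_adj G (Inr {u, v}) x" "x \<noteq> Inr {u, v}"
      by (auto simp: nbrs_def adj_total_graph)
    show "x \<in> ?S"
    proof (cases x)
      case (Inl u)
      then show ?thesis using x by auto
    next
      case (Inr e)
      then have e: "e \<in> edges G" "u \<in> e \<or> v \<in> e" "e \<noteq> {u, v}" using x by auto
      then obtain a b where ab: "e = {a, b}" "adj G a b" "adj G b a"
        using simple_graph_edgeE[OF G] adj_commute by metis
      then have "a \<in> verts G" "b \<in> verts G" using simple_graph_adjD[OF G] by auto
      then have "e \<in> (\<lambda>w. {u, w}) ` ?A \<union> (\<lambda>w. {v, w}) ` ?B"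
        using e(2,3) ab by (auto simp: nbrs_def insert_commute)
      then show ?thesis using Inr by auto
    qed
  qed
  then have "card (nbrs (total_graph G) (Inr {u, v})) \<le> card ?S"
    by (intro card_mono) (auto simp: finite_nbrs[OF G])
  also have "\<dots> \<le> card {Inl u, Inl v :: 'a + 'a set} +
      (card ((\<lambda>w. Inr {u, w}) ` ?A :: ('a + 'a set) set) +
       card ((\<lambda>w. Inr {v, w}) ` ?B :: ('a + 'a set) set))"
    by (intro order_trans[OF card_Un_le] add_left_mono card_Un_le)
  also have "\<dots> \<le> 2 + (card ?A + card ?B)"
    by (intro add_mono card_image_le finite_Diff finite_nbrs[OF G]) (auto simp: card_insert_if)
  also have "\<dots> = card (nbrs G u) + card (nbrs G v)"
  proof -
    have "v \<in> nbrs G u" "u \<in> nbrs G v"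
      using uv simple_graph_adjD[OF G uv] by (auto simp: nbrs_def adj_commute)
    then show ?thesis
      using card_Suc_Diff1[OF finite_nbrs[OF G]] by (metis add_Suc add_Suc_right add_2_eq_Suc)
  qed
  finally show ?thesis .
qed

section \<open>Products of stars: adjacency, degrees and the kinds of edges\<close>

lemma adj_cart_prod:
  "adj (cart_prod G H) (u, v) (u', v') \<longleftrightarrow>
    u \<in> verts G \<and> v \<in> verts H \<and> u' \<in> verts G \<and> v' \<in> verts H \<and>
    (v = v' \<and> adj G u u' \<or> u = u' \<and> adj H v v')"
  by (subst adj_def, unfold cart_prod_def snd_conv mem_Collect_eq doubleton_eq_iff)
    (auto simp: adj_commute)

lemma card_nbrs_cart_prod:
  assumes "simple_graph G" "simple_graph H"
  shows "card (nbrs (cart_prod G H) (u, v)) \<le> card (nbrs G u) + card (nbrs H v)"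
proof -
  have "nbrs (cart_prod G H) (u, v) \<subseteq> (\<lambda>u'. (u', v)) ` nbrs G u \<union> (\<lambda>v'. (u, v')) ` nbrs H v"
    by (auto simp: nbrs_def adj_cart_prod)
  then have "card (nbrs (cart_prod G H) (u, v)) \<le>
      card ((\<lambda>u'. (u', v)) ` nbrs G u \<union> (\<lambda>v'. (u, v')) ` nbrs H v)"
    using assms by (intro card_mono) (auto simp: finite_nbrs)
  also have "\<dots> \<le> card ((\<lambda>u'. (u', v)) ` nbrs G u) + card ((\<lambda>v'. (u, v')) ` nbrs H v)"
    by (rule card_Un_le)
  also have "\<dots> \<le> card (nbrs G u) + card (nbrs H v)"
    using assms by (intro add_mono card_image_le finite_nbrs)
  finally show ?thesis .
qed

lemma verts_star_graph: "verts (star_graph n) = {0..n}"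
  by (simp add: star_graph_def)

lemma adj_star_graph:
  "adj (star_graph n) i j \<longleftrightarrow> i = 0 \<and> j \<in> {1..n} \<or> j = 0 \<and> i \<in> {1..n}"
  by (auto simp: adj_def star_graph_def doubleton_eq_iff)

lemma card_nbrs_star_graph:
  "card (nbrs (star_graph n) i) \<le> (if i = 0 then n else 1)"
proof -
  have "nbrs (star_graph n) i \<subseteq> (if i = 0 then {1..n} else {0})"
    by (auto simp: nbrs_def adj_star_graph)
  then have "card (nbrs (star_graph n) i) \<le> card (if i = 0 then {1..n} else {0})"
    by (rule card_mono[rotated]) simp
  then show ?thesis by (simp split: if_splits)
qed

abbreviation star_prod :: "nat \<Rightarrow> nat \<Rightarrow> (nat \<times> nat) graph" where
  "star_prod n m \<equiv> cart_prod (star_graph n) (star_graph m)"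

lemma simple_graph_star_prod: "simple_graph (star_prod n m)"
  by (intro simple_graph_cart_prod simple_graph_star_graph)

lemma verts_star_prod: "verts (star_prod n m) = {0..n} \<times> {0..m}"
  by (simp add: cart_prod_def verts_star_graph)

lemma adj_star_prod:
  "adj (star_prod n m) (i, j) (i', j') \<longleftrightarrow>
    i \<le> n \<and> j \<le> m \<and> i' \<le> n \<and> j' \<le> m \<and>
    (j = j' \<and> (i = 0 \<and> i' \<noteq> 0 \<or> i' = 0 \<and> i \<noteq> 0) \<or>
     i = i' \<and> (j = 0 \<and> j' \<noteq> 0 \<or> j' = 0 \<and> j \<noteq> 0))"
  by (auto simp: adj_cart_prod verts_star_graph adj_star_graph)

lemma card_nbrs_star_prod:
  "card (nbrs (star_prod n m) (i, j)) \<le> (if i = 0 then n else 1) + (if j = 0 then m else 1)"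
  using card_nbrs_cart_prod[OF simple_graph_star_graph simple_graph_star_graph, of n m i j]
    card_nbrs_star_graph[of n i] card_nbrs_star_graph[of m j] by linarith

text \<open>Each edge is written with the end nearer to \<open>(0, 0)\<close> first, the form in
  which the values of the edge coloring are computed later.\<close>

lemma edges_star_prodE:
  assumes "e \<in> edges (star_prod n m)"
  obtains i where "i \<in> {1..n}" "e = {(0, 0), (i, 0)}"
  | j where "j \<in> {1..m}" "e = {(0, 0), (0, j)}"
  | i j where "i \<in> {1..n}" "j \<in> {1..m}" "e = {(i, 0), (i, j)}"
  | i j where "i \<in> {1..n}" "j \<in> {1..m}" "e = {(0, j), (i, j)}"
proof -
  obtain i j i' j' where e: "e = {(i, j), (i', j')}" "adj (star_prod n m) (i, j) (i', j')"
    using simple_graph_edgeE[OF simple_graph_star_prod assms] by (metis surj_pair)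
  then consider "j = j'" "i = 0" "i' \<in> {1..n}" "j \<le> m" | "j = j'" "i' = 0" "i \<in> {1..n}" "j \<le> m"
    | "i = i'" "j = 0" "j' \<in> {1..m}" "i \<le> n" | "i = i'" "j' = 0" "j \<in> {1..m}" "i \<le> n"
    by (auto simp: adj_star_prod)
  then show ?thesis
  proof cases
    case 1
    then show ?thesis using e(1) that(1)[of i'] that(4)[of i' j] by (cases "j = 0") auto
  next
    case 2
    then have "e = {(i', j'), (i, j)}" using e(1) by blast
    then show ?thesis using 2 that(1)[of i] that(4)[of i j] by (cases "j = 0") auto
  next
    case 3
    then show ?thesis using e(1) that(2)[of j'] that(3)[of i j'] by (cases "i = 0") auto
  next
    case 4
    then have "e = {(i', j'), (i, j)}" using e(1) by blast
    then show ?thesis using 4 that(2)[of j] that(3)[of i j] by (cases "i = 0") auto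
  qed
qed

section \<open>The upper bound\<close>

text \<open>With \<open>i\<close> and \<open>j\<close> positive, the elements to be excluded have
  small degree: at most \<open>2 * m + 2\<close> for \<open>(i, 0)\<close>, 4 for
  \<open>(i, j)\<close>, \<open>m + 3\<close> for the edge from \<open>(i, 0)\<close> to
  \<open>(i, j)\<close>, and \<open>n + 3\<close> for the edge from \<open>(0, j)\<close> to
  \<open>(i, j)\<close>. The vertices \<open>(0, j)\<close> have degree at most
  \<open>2 * n + 2\<close>, hence the conditional last set.\<close>

lemma large_degree_star_prod:
  assumes x: "x \<in> verts (total_graph (star_prod n m))"
    and d: "2 * m + 3 \<le> card (nbrs (total_graph (star_prod n m)) x)"
      "n + 4 \<le> card (nbrs (total_graph (star_prod n m)) x)" and "n \<ge> m" "m \<ge> 3"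
  shows "x \<in> {Inl (0, 0)} \<union> (\<lambda>i. Inr {(0, 0), (i, 0)}) ` {1..n} \<union>
    (\<lambda>j. Inr {(0, 0), (0, j)}) ` {1..m} \<union>
    (if card (nbrs (total_graph (star_prod n m)) x) \<le> 2 * n + 2 then Inl ` Pair 0 ` {1..m} else {})"
proof (cases x)
  case (Inl p)
  obtain i j where p: "p = (i, j)" by (cases p)
  then have "i \<le> n" "j \<le> m" using x Inl by (auto simp: verts_total_graph verts_star_prod)
  moreover have "card (nbrs (total_graph (star_prod n m)) x) \<le>
      2 * ((if i = 0 then n else 1) + (if j = 0 then m else 1))"
    using card_nbrs_total_graph_Inl[OF simple_graph_star_prod, of n m p]
      card_nbrs_star_prod[of n m i j] Inl p by simp
  ultimately show ?thesis
    using d Inl p \<open>n \<ge> m\<close> \<open>m \<ge> 3\<close>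
    by (cases "i = 0"; cases "j = 0") auto
next
  case (Inr e)
  then have e: "e \<in> edges (star_prod n m)" using x by (auto simp: verts_total_graph)
  have D: "card (nbrs (total_graph (star_prod n m)) (Inr {(i, j), (i', j')})) \<le>
     (if i = 0 then n else 1) + (if j = 0 then m else 1) +
     ((if i' = 0 then n else 1) + (if j' = 0 then m else 1))" 
     if "e = {(i, j), (i', j')}" for i j i' j'
    using card_nbrs_total_graph_Inr[OF simple_graph_star_prod, of n m "(i, j)" "(i', j')"]
      card_nbrs_star_prod[of n m i j] card_nbrs_star_prod[of n m i' j'] e
    unfolding adj_def that by linarith
  from e show ?thesis
  proof (cases rule: edges_star_prodE)
    case (3 i j)
    then show ?thesis using D[of i 0 i j] d Inr \<open>n \<ge> m\<close> \<open>m \<ge> 3\<close> by simp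
  next
    case (4 i j)
    then show ?thesis using D[of 0 j i j] d Inr \<open>n \<ge> m\<close> \<open>m \<ge> 3\<close> by simp
  qed (use Inr in auto)
qed

text \<open>A larger \<open>k\<close> would leave too few vertices of degree at least
  \<open>k - 1\<close>: at most \<open>1 + n + 2 * m\<close> of them in the first case. In the
  second case the degree has to exceed \<open>2 * n + 2\<close>, which rules out all
  \<open>(0, j)\<close> and leaves at most \<open>1 + n + m\<close>.\<close>

lemma b_coloring_star_prod_le:
  assumes "n \<ge> m" "m \<ge> 3" and c: "b_coloring (total_graph (star_prod n m)) k c"
  shows "k \<le> (if n > 2 * (m - 1) then 2 * m + n + 1 else 2 * n + 3)"
proof (rule ccontr)
  let ?T = "total_graph (star_prod n m)"
  let ?K = "{Inl (0, 0)} \<union> (\<lambda>i. Inr {(0, 0), (i, 0)}) ` {1..n} \<union>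
    (\<lambda>j. Inr {(0, 0), (0, j)}) ` {1..m} :: ((nat \<times> nat) + (nat \<times> nat) set) set"
  let ?B = "Inl ` Pair 0 ` {1..m} :: ((nat \<times> nat) + (nat \<times> nat) set) set"
  let ?D = "{v \<in> verts ?T. k \<le> card (nbrs ?T v) + 1}"
  assume neg: "\<not> k \<le> (if n > 2 * (m - 1) then 2 * m + n + 1 else 2 * n + 3)"
  have k: "k \<le> card ?D"
    by (rule b_coloring_le_card_degree[OF simple_graph_total_graph[OF simple_graph_star_prod] c])
  have D: "?D \<subseteq> (if n > 2 * (m - 1) then ?K \<union> ?B else ?K)"
  proof
    fix x assume x: "x \<in> ?D"
    let ?d = "card (nbrs ?T x)"
    have "k \<le> ?d + 1" using x by simp
    then have "2 * m + 3 \<le> ?d" "n + 4 \<le> ?d" "\<not> n > 2 * (m - 1) \<Longrightarrow> \<not> ?d \<le> 2 * n + 2"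
      using neg assms(1,2) by (auto split: if_splits)
    moreover have "x \<in> ?K \<union> (if ?d \<le> 2 * n + 2 then ?B else {})"
      using x calculation(1,2) assms(1,2) by (intro large_degree_star_prod) auto
    ultimately show "x \<in> (if n > 2 * (m - 1) then ?K \<union> ?B else ?K)"
      by (auto split: if_splits)
  qed
  have "card ?K \<le> 1 + n + m"
    by (intro order_trans[OF card_Un_le] add_mono) (auto intro: order_trans[OF card_image_le])
  moreover have "card ?B \<le> m"
    by (auto simp: image_image intro: order_trans[OF card_image_le])
  moreover have "card (?K \<union> ?B) \<le> card ?K + card ?B" by (rule card_Un_le)
  moreover have "card ?D \<le> card (if n > 2 * (m - 1) then ?K \<union> ?B else ?K)"
    by (rule card_mono[OF _ D]) simp
  ultimately show False using k neg assms(1,2) by (auto split: if_splits)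
qed

section \<open>A criterion for proper colorings of total graphs\<close>

text \<open>The conditions range over ordered adjacent pairs, so \<open>incident\<close> covers both
  ends of an edge, and \<open>edges\<close> covers any two edges once their common end is called
  \<open>u\<close>.\<close>

lemma proper_coloring_total_graphI:
  assumes G: "simple_graph G"
    and "\<And>v. v \<in> verts G \<Longrightarrow> f v \<in> {1..k}"
    and "\<And>e. e \<in> edges G \<Longrightarrow> g e \<in> {1..k}"
    and vertices: "\<And>u v. adj G u v \<Longrightarrow> f u \<noteq> f v"
    and incident: "\<And>u v. adj G u v \<Longrightarrow> g {u, v} \<noteq> f u"
    and edges: "\<And>u v w. adj G u v \<Longrightarrow> adj G u w \<Longrightarrow> v \<noteq> w \<Longrightarrow> g {u, v} \<noteq> g {u, w}"
  shows "proper_coloring (total_graph G) k (case_sum f g)"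
proof -
  have I: "g e \<noteq> f u" if e: "e \<in> edges G" and u: "u \<in> e" for e u
  proof -
    obtain a b where "e = {a, b}" "adj G a b" by (rule simple_graph_edgeE[OF G e])
    then show ?thesis
      using u incident[of a b] incident[of b a] by (auto simp: adj_commute insert_commute)
  qed
  have E: "g e \<noteq> g e'" if e: "e \<in> edges G" "e' \<in> edges G" "e \<inter> e' \<noteq> {}" "e \<noteq> e'" for e e'
  proof -
    obtain u where u: "u \<in> e" "u \<in> e'" using e(3) by blast
    have *: "\<exists>v. e = {u, v} \<and> adj G u v" if "e \<in> edges G" "u \<in> e" for e
    proof -
      obtain a b where "e = {a, b}" "adj G a b"
        using simple_graph_edgeE[OF G \<open>e \<in> edges G\<close>] .
      then show ?thesis using \<open>u \<in> e\<close> adj_commute by (metis insert_commute insert_iff singletonD)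
    qed
    show ?thesis
      using *[OF e(1) u(1)] *[OF e(2) u(2)] e(4) edges by fastforce
  qed
  have "case_sum f g x \<noteq> case_sum f g y" if "adj (total_graph G) x y" for x y
    using that vertices I E by (cases x; cases y) (fastforce simp: adj_total_graph)+
  then show ?thesis
    unfolding proper_coloring_def using assms(2,3) by (auto simp: verts_total_graph)
qed

section \<open>Cyclic shifts and the explicit coloring\<close>

text \<open>Addition modulo \<open>q\<close> with representatives \<open>1, ..., q\<close> in place
  of \<open>0, ..., q - 1\<close>, meant for \<open>j\<close> in \<open>{1..q}\<close> and
  \<open>0 < i < q\<close>.\<close>

definition shift :: "nat \<Rightarrow> nat \<Rightarrow> nat \<Rightarrow> nat" where
  "shift q j i = (if j + i \<le> q then j + i else j + i - q)"

lemma shift_surj: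
  assumes "j \<in> {1..q}" "l \<in> {1..q}" "l \<noteq> j"
  obtains i where "i \<in> {1..<q}" "shift q j i = l"
proof (cases "l > j")
  case True
  then show ?thesis using assms by (intro that[of "l - j"]) (auto simp: shift_def)
next
  case False
  \<comment> \<open>Here \<open>l < j\<close>, so the shift has to wrap around once.\<close>
  then show ?thesis using assms by (intro that[of "l + q - j"]) (auto simp: shift_def)
qed

lemma shift_bounds:
  assumes "0 < j" "j \<le> q" "0 < i" "i < q"
  shows "0 < shift q j i" "shift q j i \<le> q" "shift q j i \<noteq> j"
  using assms by (auto simp: shift_def)

text \<open>The leaves \<open>i = t, ..., t + q - 2\<close> are renumbered to the shift amounts
  \<open>1, ..., q - 1\<close>.\<close>

lemma shift_diff_bounds:
  assumes "0 < j" "j \<le> q" "t \<le> i" "Suc i < t + q"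
  shows "0 < shift q j (Suc i - t)" "shift q j (Suc i - t) \<le> q" "shift q j (Suc i - t) \<noteq> j"
  using assms shift_bounds[of j q "Suc i - t"] by auto

lemma shift_inject:
  assumes "i < q" "i' < q" "0 < i" "0 < i'" "0 < j" "j \<le> q"
  shows "shift q j i = shift q j i' \<longleftrightarrow> i = i'"
  using assms by (auto simp: shift_def split: if_splits)

text \<open>
  The palette: \<open>1\<close> belongs to \<open>(0, 0)\<close>, \<open>1 + i\<close> to the edge from \<open>(0, 0)\<close> to \<open>(i, 0)\<close>, \<open>1 + n + j\<close> to
  the edge from \<open>(0, 0)\<close> to \<open>(0, j)\<close>, and \<open>1 + n + m + j\<close>, for \<open>j \<le> t\<close>, to the vertex \<open>(0, j)\<close>.
\<close>

fun vertex_colour :: "nat \<Rightarrow> nat \<Rightarrow> nat \<Rightarrow> nat \<times> nat \<Rightarrow> nat" where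
  "vertex_colour n m t (i, j) =
    (if i = 0 then if j = 0 then 1 else if j \<le> t then 1 + n + m + j else 2 + n
     else if j = 0 then if i = 1 then 3 else 2
     else if j > t then 1
     else if i < t then 1 + i
     else if i + 1 < t + m then 1 + n + shift m j (i + 1 - t)
     else 1)"

text \<open>The maxima recover the end of the edge that is farther from \<open>(0, 0)\<close>.\<close>

definition edge_colour :: "nat \<Rightarrow> nat \<Rightarrow> nat \<Rightarrow> (nat \<times> nat) set \<Rightarrow> nat" where
  "edge_colour n m t e =
    (let i = Max (fst ` e); j = Max (snd ` e) in
     if j = 0 then 1 + i
     else if i = 0 then 1 + n + j
     else if (i, 0) \<in> e then if j \<le> t then 1 + n + m + j else 1 + n + j
     else if j \<le> t then if i < t then 1 + n + m + shift t j i else 1 + i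
     else if i \<le> t then 1 + n + m + i else 1 + i)"

lemma edge_colour_simps:
  "edge_colour n m t {(0, 0), (i, 0)} = 1 + i"
  "j \<noteq> 0 \<Longrightarrow> edge_colour n m t {(0, 0), (0, j)} = 1 + n + j"
  "i \<noteq> 0 \<Longrightarrow> j \<noteq> 0 \<Longrightarrow> edge_colour n m t {(i, 0), (i, j)} =
    (if j \<le> t then 1 + n + m + j else 1 + n + j)"
  "i \<noteq> 0 \<Longrightarrow> j \<noteq> 0 \<Longrightarrow> edge_colour n m t {(0, j), (i, j)} =
    (if j \<le> t then if i < t then 1 + n + m + shift t j i else 1 + i
     else if i \<le> t then 1 + n + m + i else 1 + i)"
  by (auto simp: edge_colour_def Let_def)

lemma edge_colour_simps':
  "edge_colour n m t {(i, 0), (0, 0)} = edge_colour n m t {(0, 0), (i, 0)}"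
  "edge_colour n m t {(0, j), (0, 0)} = edge_colour n m t {(0, 0), (0, j)}"
  "edge_colour n m t {(i, j), (i, 0)} = edge_colour n m t {(i, 0), (i, j)}"
  "edge_colour n m t {(i, j), (0, j)} = edge_colour n m t {(0, j), (i, j)}"
  by (simp_all add: insert_commute)

lemma vertex_colour_bounds:
  assumes "n \<ge> m" "m \<ge> 3" "t \<ge> 2" "t \<le> m" "t + m \<le> n + 2" "i \<le> n" "j \<le> m"
  shows "vertex_colour n m t (i, j) \<in> {1..1 + n + m + t}"
  using assms shift_diff_bounds[of j m t i] by auto

text \<open>Most conflicts are avoided because the colors come from different blocks of the palette.
  Within a block, a nonzero shift moves \<open>j\<close>, so edges from \<open>(0, j)\<close> to
  \<open>(i, j)\<close> avoid the private color of \<open>(0, j)\<close>. The vertex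
  \<open>(i, 0)\<close> has color 2, or 3 if \<open>i = 1\<close>, to avoid \<open>1 + i\<close>.
  For \<open>j > t\<close> the color \<open>2 + n\<close> of \<open>(0, j)\<close> differs from
  \<open>1 + n + j\<close> since \<open>j > 1\<close>.\<close>

lemma proper_coloring_star_prod:
  assumes "n \<ge> m" "m \<ge> 3" "t \<ge> 2" "t \<le> m" "t + m \<le> n + 2"
  shows "proper_coloring (total_graph (star_prod n m)) (1 + n + m + t)
    (case_sum (vertex_colour n m t) (edge_colour n m t))"
proof (rule proper_coloring_total_graphI[OF simple_graph_star_prod])
  fix v assume "v \<in> verts (star_prod n m)"
  then show "vertex_colour n m t v \<in> {1..1 + n + m + t}"
    using vertex_colour_bounds[OF assms] by (auto simp: verts_star_prod simp del: vertex_colour.simps)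
next
  fix e assume "e \<in> edges (star_prod n m)"
  then show "edge_colour n m t e \<in> {1..1 + n + m + t}"
    using assms
  proof (cases rule: edges_star_prodE)
    case (4 i j)
    then show ?thesis using assms shift_bounds[of j t i] by (auto simp: edge_colour_simps)
  qed (auto simp: edge_colour_simps)
next
  fix u v assume uv: "adj (star_prod n m) u v"
  obtain i j i' j' where [simp]: "u = (i, j)" "v = (i', j')" by (metis surj_pair)
  note sh = shift_diff_bounds[of j m t i] shift_diff_bounds[of j' m t i']
    shift_bounds[of j t i] shift_bounds[of j t i']
  show "vertex_colour n m t u \<noteq> vertex_colour n m t v"
    using uv assms sh(1-6)
    by (cases "i = 0"; cases "j = 0"; cases "i' = 0"; cases "j' = 0")
      (auto simp: adj_star_prod)
  show "edge_colour n m t {u, v} \<noteq> vertex_colour n m t u"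
    using uv assms sh
    by (cases "i = 0"; cases "j = 0"; cases "i' = 0"; cases "j' = 0")
      (simp_all add: adj_star_prod edge_colour_simps edge_colour_simps' split: if_splits, auto)
next
  fix u v w assume uv: "adj (star_prod n m) u v" "adj (star_prod n m) u w" "v \<noteq> w"
  obtain i j i' j' i'' j'' where [simp]: "u = (i, j)" "v = (i', j')" "w = (i'', j'')"
    by (metis surj_pair)
  note [simp] = adj_star_prod edge_colour_simps edge_colour_simps'
  consider "i = 0" "j = 0" | "i \<noteq> 0" "j = 0" | "i = 0" "j \<noteq> 0" | "i \<noteq> 0" "j \<noteq> 0"
    by blast
  then show "edge_colour n m t {u, v} \<noteq> edge_colour n m t {u, w}"
  proof cases
    case 1
    then show ?thesis using uv by auto
  next
    case 2
    then have "v = (0, 0) \<or> v = (i, j') \<and> j' \<noteq> 0" "w = (0, 0) \<or> w = (i, j'') \<and> j'' \<noteq> 0"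
      using uv by auto
    then show ?thesis using 2 uv by (elim disjE conjE) (auto split: if_splits)
  next
    case 3
    then have "v = (0, 0) \<or> v = (i', j) \<and> i' \<noteq> 0" "w = (0, 0) \<or> w = (i'', j) \<and> i'' \<noteq> 0"
      using uv by auto
    \<comment> \<open>For \<open>j \<le> t\<close>, two edges with private colors are separated by
      injectivity of the shift, and those colored \<open>1 + i\<close> by \<open>i\<close>
      itself.\<close>
    then show ?thesis
      using 3 uv assms shift_bounds[of j t i'] shift_bounds[of j t i'']
        shift_inject[of i' t i'' j]
      by (elim disjE conjE) (auto split: if_splits)
  next
    case 4
    then have "v = (0, j) \<or> v = (i, 0)" "w = (0, j) \<or> w = (i, 0)"
      using uv by auto
    then show ?thesis
      using 4 uv assms shift_bounds[of j t i] by (elim disjE) (auto split: if_splits)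
  qed
qed

section \<open>A b-vertex for every color\<close>

lemma edges_star_prodI:
  "i \<in> {1..n} \<Longrightarrow> {(0, 0), (i, 0)} \<in> edges (star_prod n m)"
  "j \<in> {1..m} \<Longrightarrow> {(0, 0), (0, j)} \<in> edges (star_prod n m)"
  "i \<in> {1..n} \<Longrightarrow> j \<in> {1..m} \<Longrightarrow> {(i, 0), (i, j)} \<in> edges (star_prod n m)"
  "i \<in> {1..n} \<Longrightarrow> j \<in> {1..m} \<Longrightarrow> {(0, j), (i, j)} \<in> edges (star_prod n m)"
  unfolding adj_def[symmetric] by (auto simp: adj_star_prod)

lemma b_vertexI:
  assumes "x \<in> verts G" "\<And>l. l \<in> {1..k} \<Longrightarrow> l \<noteq> c x \<Longrightarrow> \<exists>y\<in>nbrs G x. c y = l"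
  shows "b_vertex G k c x"
  using assms by (fastforce simp: b_vertex_def nbrs_def)

lemma colour_cases:
  fixes l n m t :: nat
  assumes "l \<in> {1..1 + n + m + t}"
  obtains "l = 1" | i where "i \<in> {1..n}" "l = 1 + i" | j where "j \<in> {1..m}" "l = 1 + n + j"
    | j where "j \<in> {1..t}" "l = 1 + n + m + j"
proof -
  consider "l = 1" | "l - 1 \<in> {1..n}" | "l - (1 + n) \<in> {1..m}" | "l - (1 + n + m) \<in> {1..t}"
    using assms unfolding atLeastAtMost_iff by linarith
  then show ?thesis
    using that(1) that(2)[of "l - 1"] that(3)[of "l - (1 + n)"] that(4)[of "l - (1 + n + m)"]
    by cases auto
qed

text \<open>The clique formed by \<open>(0, 0)\<close> and its edges shows all nonprivate colors to
  each of its members, so only the private colors need other neighbours there. The vertices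
  \<open>(0, j)\<close> with \<open>j \<le> t\<close> carry the private colors and are where
  \<open>t + m \<le> n + 2\<close> provides enough leaves.\<close>

lemma b_coloring_star_prod:
  assumes "n \<ge> m" "m \<ge> 3" "t \<ge> 2" "t \<le> m" "t + m \<le> n + 2"
  shows "b_coloring (total_graph (star_prod n m)) (1 + n + m + t)
    (case_sum (vertex_colour n m t) (edge_colour n m t))"
proof -
  let ?T = "total_graph (star_prod n m)" and ?k = "1 + n + m + t"
  let ?c = "case_sum (vertex_colour n m t) (edge_colour n m t)"
  note [simp] = nbrs_def adj_total_graph verts_total_graph verts_star_prod edges_star_prodI
    edge_colour_simps doubleton_eq_iff
  have z: "b_vertex ?T ?k ?c (Inl (0, 0))"
  proof (rule b_vertexI)
    fix l assume l: "l \<in> {1..?k}" "l \<noteq> ?c (Inl (0, 0))"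
    from l(1) show "\<exists>y\<in>nbrs ?T (Inl (0, 0)). ?c y = l"
    proof (cases rule: colour_cases)
      case (2 i)
      then show ?thesis by (intro bexI[of _ "Inr {(0, 0), (i, 0)}"]) auto
    next
      case (3 j)
      then show ?thesis by (intro bexI[of _ "Inr {(0, 0), (0, j)}"]) auto
    next
      case (4 j)
      then show ?thesis using assms
        by (intro bexI[of _ "Inl (0, j)"]) (auto simp: adj_star_prod)
    qed (use l in auto)
  qed auto
  have e: "b_vertex ?T ?k ?c (Inr {(0, 0), (i', 0)})" if i': "i' \<in> {1..n}" for i'
  proof (rule b_vertexI)
    fix l assume l: "l \<in> {1..?k}" "l \<noteq> ?c (Inr {(0, 0), (i', 0)})"
    from l(1) show "\<exists>y\<in>nbrs ?T (Inr {(0, 0), (i', 0)}). ?c y = l"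
    proof (cases rule: colour_cases)
      case 1
      then show ?thesis using i' by (intro bexI[of _ "Inl (0, 0)"]) auto
    next
      case (2 i)
      then show ?thesis using i' l by (intro bexI[of _ "Inr {(0, 0), (i, 0)}"]) auto
    next
      case (3 j)
      then show ?thesis using i' by (intro bexI[of _ "Inr {(0, 0), (0, j)}"]) auto
    next
      \<comment> \<open>The \<open>t\<close> private colors all appear on the edges from
        \<open>(i', 0)\<close> to \<open>(i', j)\<close>.\<close>
      case (4 j)
      then show ?thesis using i' assms
        by (intro bexI[of _ "Inr {(i', 0), (i', j)}"]) auto
    qed
  qed (use i' in auto)
  have f: "b_vertex ?T ?k ?c (Inr {(0, 0), (0, j')})" if j': "j' \<in> {1..m}" for j'
  proof (rule b_vertexI)
    fix l assume l: "l \<in> {1..?k}" "l \<noteq> ?c (Inr {(0, 0), (0, j')})"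
    from l(1) show "\<exists>y\<in>nbrs ?T (Inr {(0, 0), (0, j')}). ?c y = l"
    proof (cases rule: colour_cases)
      case 1
      then show ?thesis using j' by (intro bexI[of _ "Inl (0, 0)"]) auto
    next
      case (2 i)
      then show ?thesis using j' by (intro bexI[of _ "Inr {(0, 0), (i, 0)}"]) auto
    next
      case (3 j)
      then show ?thesis using j' l by (intro bexI[of _ "Inr {(0, 0), (0, j)}"]) auto
    next
      case (4 j)
      \<comment> \<open>For \<open>j' > t\<close> the edges from \<open>(0, j')\<close> to the first
        \<open>t\<close> leaves carry all private colors. For \<open>j' \<le> t\<close> the end
        \<open>(0, j')\<close> carries its own one and shifted edges carry the rest.\<close>
      consider "j' > t" | "j' = j" | "j' \<le> t" "j \<noteq> j'" by linarith
      then show ?thesis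
      proof cases
        case 1
        then show ?thesis using 4 j' assms
          by (intro bexI[of _ "Inr {(0, j'), (j, j')}"]) auto
      next
        case 2
        then show ?thesis using 4 j' by (intro bexI[of _ "Inl (0, j')"]) auto
      next
        case 3
        then obtain i where "i \<in> {1..<t}" "shift t j' i = j"
          using 4 j' shift_surj[of j' t j] by auto
        then show ?thesis using 3 4 j' assms
          by (intro bexI[of _ "Inr {(0, j'), (i, j')}"]) auto
      qed
    qed
  qed (use j' in auto)
  have b: "b_vertex ?T ?k ?c (Inl (0, j'))" if j': "j' \<in> {1..t}" for j'
  proof (rule b_vertexI)
    fix l assume l: "l \<in> {1..?k}" "l \<noteq> ?c (Inl (0, j'))"
    from l(1) show "\<exists>y\<in>nbrs ?T (Inl (0, j')). ?c y = l"
    proof (cases rule: colour_cases)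
      case 1
      then show ?thesis using j' assms
        by (intro bexI[of _ "Inl (0, 0)"]) (auto simp: adj_star_prod)
    next
      case (2 i)
      show ?thesis
      \<comment> \<open>The edges to leaves with \<open>i < t\<close> are taken up by private
        colors, so there the vertex \<open>(i, j')\<close> supplies \<open>1 + i\<close>
        instead.\<close>
      proof (cases "i < t")
        case True
        then show ?thesis using 2 j' assms
          by (intro bexI[of _ "Inl (i, j')"]) (auto simp: adj_star_prod)
      next
        case False
        then show ?thesis using 2 j' assms
          by (intro bexI[of _ "Inr {(0, j'), (i, j')}"]) auto
      qed
    next
      case (3 j)
      show ?thesis
      proof (cases "j = j'")
        case True
        then show ?thesis using 3 j' by (intro bexI[of _ "Inr {(0, 0), (0, j')}"]) auto
      next
        case False
        then obtain i where "i \<in> {1..<m}" "shift m j' i = j"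
          using 3 j' assms shift_surj[of j' m j] by auto
        \<comment> \<open>The leaf \<open>i + t - 1\<close> undoes the offset in
          \<open>vertex_colour\<close>. It exists because \<open>i \<le> m - 1\<close> and
          \<open>t + m \<le> n + 2\<close>.\<close>
        then show ?thesis using 3 j' assms
          by (intro bexI[of _ "Inl (i + t - 1, j')"]) (auto simp: adj_star_prod)
      qed
    next
      case (4 j)
      then have "j \<noteq> j'" using l j' by auto
      then obtain i where "i \<in> {1..<t}" "shift t j' i = j"
        using 4 j' shift_surj[of j' t j] by auto
      then show ?thesis using 4 j' assms
        by (intro bexI[of _ "Inr {(0, j'), (i, j')}"]) auto
    qed
  qed (use j' assms in auto)
  have "\<exists>x. b_vertex ?T ?k ?c x \<and> ?c x = l" if "l \<in> {1..?k}" for l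
    using that
  proof (cases rule: colour_cases)
    case 1
    then show ?thesis by (intro exI[of _ "Inl (0, 0)"] conjI z) simp
  next
    case (2 i)
    then show ?thesis by (intro exI[of _ "Inr {(0, 0), (i, 0)}"] conjI e) auto
  next
    case (3 j)
    then show ?thesis by (intro exI[of _ "Inr {(0, 0), (0, j)}"] conjI f) auto
  next
    case (4 j)
    then show ?thesis by (intro exI[of _ "Inl (0, j)"] conjI b) auto
  qed
  then show ?thesis
    using proper_coloring_star_prod[OF assms] by (simp add: b_coloring_def)
qed

theorem theorem3p3:
  fixes n m :: nat
  assumes "n \<ge> m" and "m \<ge> 3"
  shows "b_chromatic_number (total_graph (cart_prod (star_graph n) (star_graph m))) =
    (if n > 2 * (m - 1) then 2 * m + n + 1 else 2 * n + 3)"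
proof -
  \<comment> \<open>This is the minimum of \<open>m\<close> and \<open>n + 2 - m\<close>, and
    \<open>n \<ge> m \<ge> 3\<close> makes it at least 2.\<close>
  define t where "t = (if n > 2 * (m - 1) then m else n + 2 - m)"
  have "b_coloring (total_graph (star_prod n m)) (1 + n + m + t)
      (case_sum (vertex_colour n m t) (edge_colour n m t))"
    using assms by (intro b_coloring_star_prod) (auto simp: t_def)
  moreover have "1 + n + m + t = (if n > 2 * (m - 1) then 2 * m + n + 1 else 2 * n + 3)"
    using assms by (auto simp: t_def)
  ultimately show ?thesis
    using b_coloring_star_prod_le[OF assms]
    by (intro b_chromatic_number_eqI simple_graph_total_graph simple_graph_star_prod) auto
qed

end
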